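(* Let $N\ge2$, $\Omega=\mathbb{R}^{N-1}\times(0,\infty)$, $(\phi,\psi)\in L^p(\Omega)\times L^p(\partial\Omega)$ with $p\in[1,\infty)$, and fix $\epsilon>0$, $\delta>0$. With $u_k$, $z^D$, $f_p$ as in the context, for every $R>0$, \[\sup_{(x,t)\in Q(R)}|u_k(x,t)-z^D(x,t)|=O(f_p(k))\quad\text{as }k\to\infty.\]
   Context: $x=(x',x_N)$, $\partial\Omega\cong\mathbb{R}^{N-1}$ with surface measure $d\sigma$, $\Delta'$ the Laplacian in $x'$. $\Gamma_d(x,t)=(4\pi t)^{-d/2}e^{-|x|^2/(4t)}$, $\partial_\xi\Gamma_1$ the spatial derivative of $\Gamma_1$, $y^*=(y',-y_N)$, $G_0(x,y,s)=\Gamma_N(x-y,s)-\Gamma_N(x-y^*,s)$. For $k>0$: $H(x,y,t)=-2\int_0^t\Gamma_{N-1}(x'-y',\frac{t-\tau}\epsilon+\frac k\delta\tau)\partial_\xi\Gamma_1(x_N+y_N+\frac\tau\delta,\frac{t-\tau}\epsilon)d\tau$, $G=G_0(x,y,t/\epsilon)+\delta^{-1}H$, $u_k(x,t)=\int_\Omega G(x,y,t)\phi(y)dy+\frac\delta\epsilon\int_{\partial\Omega}G(x,y,t)\psi(y)d\sigma(y)$ (solution of $\epsilon\partial_tu=\Delta u$ in $\Omega$, $\delta\partial_tu-k\Delta'u-\partial_{x_N}u=0$ on $\partial\Omega$, initial data $(\phi,\psi)$). $z^D(x,t)=\int_\Omega G_0(x,y,t/\epsilon)\phi(y)dy$. $Q(R)=\{(x,t)\in\overline\Omega\times(0,\infty):x_N+t>R\}$.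 With $p_N=(N-1)/2$, $f_p(r)=r^{-1}$ if $p<p_N$, $r^{-1}\log r$ if $p=p_N$, $r^{-\frac{N-1}{2p}}$ if $p>p_N$, for $r>1$. *)

theory Defs
  imports "HOL-Analysis.Analysis"
begin

text \<open>Points of R^N are pairs (x', x_N) with x' in an abstract Euclidean space 'a of
dimension N-1 = DIM('a) (so N = DIM('a)+1 >= 2 automatically).\<close>

definition half_space :: "('a::euclidean_space \<times> real) set" where
  "half_space = {y. snd y > 0}"

definition heat_kernel :: "nat \<Rightarrow> 'b::real_normed_vector \<Rightarrow> real \<Rightarrow> real" where
  "heat_kernel d z s = (4 * pi * s) powr (- (real d / 2)) * exp (- (norm z)\<^sup>2 / (4 * s))"

definition dGamma1 :: "real \<Rightarrow> real \<Rightarrow> real" where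
  "dGamma1 \<xi> s = deriv (\<lambda>\<eta>. heat_kernel 1 \<eta> s) \<xi>"

definition refl_pt :: "'a::euclidean_space \<times> real \<Rightarrow> 'a \<times> real" where
  "refl_pt y = (fst y, - snd y)"

definition G0 :: "'a::euclidean_space \<times> real \<Rightarrow> 'a \<times> real \<Rightarrow> real \<Rightarrow> real" where
  "G0 x y s = heat_kernel (DIM('a) + 1) (x - y) s - heat_kernel (DIM('a) + 1) (x - refl_pt y) s"

definition Hk :: "real \<Rightarrow> real \<Rightarrow> real \<Rightarrow> 'a::euclidean_space \<times> real \<Rightarrow> 'a \<times> real \<Rightarrow> real \<Rightarrow> real" where
  "Hk \<epsilon> \<delta> k x y t = - 2 * (LBINT \<tau>=0..t.
      heat_kernel DIM('a) (fst x - fst y) ((t - \<tau>) / \<epsilon> + k / \<delta> * \<tau>) *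
      dGamma1 (snd x + snd y + \<tau> / \<delta>) ((t - \<tau>) / \<epsilon>))"

definition Gk :: "real \<Rightarrow> real \<Rightarrow> real \<Rightarrow> 'a::euclidean_space \<times> real \<Rightarrow> 'a \<times> real \<Rightarrow> real \<Rightarrow> real" where
  "Gk \<epsilon> \<delta> k x y t = G0 x y (t / \<epsilon>) + Hk \<epsilon> \<delta> k x y t / \<delta>"

text \<open>u_k; the boundary integral is over \<partial>\<Omega> = {(y',0)} identified with R^(N-1).\<close>
definition u_k :: "real \<Rightarrow> real \<Rightarrow> real \<Rightarrow> ('a::euclidean_space \<times> real \<Rightarrow> real) \<Rightarrow> ('a \<Rightarrow> real)
    \<Rightarrow> 'a \<times> real \<Rightarrow> real \<Rightarrow> real" where
  "u_k \<epsilon> \<delta> k \<phi> \<psi> x t =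
     (LINT y:half_space|lebesgue. Gk \<epsilon> \<delta> k x y t * \<phi> y)
     + \<delta> / \<epsilon> * (LINT y'|lebesgue. Gk \<epsilon> \<delta> k x (y', 0) t * \<psi> y')"

definition zD :: "real \<Rightarrow> ('a::euclidean_space \<times> real \<Rightarrow> real) \<Rightarrow> 'a \<times> real \<Rightarrow> real \<Rightarrow> real" where
  "zD \<epsilon> \<phi> x t = (LINT y:half_space|lebesgue. G0 x y (t / \<epsilon>) * \<phi> y)"

definition Qset :: "real \<Rightarrow> (('a::euclidean_space \<times> real) \<times> real) set" where
  "Qset R = {(x, t). snd x \<ge> 0 \<and> t > 0 \<and> snd x + t > R}"

text \<open>f_p with p_N = (N-1)/2 where N-1 = n.\<close>
definition f_p :: "real \<Rightarrow> nat \<Rightarrow> real \<Rightarrow> real" where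
  "f_p p n r = (if p < real n / 2 then 1 / r
                else if p = real n / 2 then ln r / r
                else r powr (- (real n / (2 * p))))"

end

theory Submission
  imports Defs "HOL-Probability.Distributions" "HOL-Real_Asymp.Real_Asymp"
begin

text \<open>Since \<open>G\<^sub>0\<close> vanishes for \<open>y\<^sub>N = 0\<close>, the difference \<open>u\<^sub>k - z\<^sup>D\<close> is a superposition over \<open>\<tau>\<close> of the
  data integrated against the integrand of \<open>H\<close>. With \<open>s = (t - \<tau>) / \<epsilon>\<close>, \<open>\<sigma> = s + k \<tau> / \<delta>\<close>,
  \<open>a = x\<^sub>N + \<tau> / \<delta>\<close> and \<open>\<alpha> = (N - 1) / (2 p)\<close>, a Hoelder-type estimate in space bounds the
  contribution of each \<open>\<tau>\<close> by \<open>\<sigma>\<^sup>-\<^sup>\<alpha> (s\<^sup>-\<^sup>1\<^sup>/\<^sup>2 + s\<^sup>-\<^sup>1) exp (- a\<^sup>2 / (8 s))\<close>. On \<open>Q(R)\<close> the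
  quantity \<open>s + a\<^sup>2\<close> is at least a multiple of \<open>(1 + \<tau>)\<^sup>2\<close>, and trading the exponential for a
  power of \<open>s / (s + a\<^sup>2)\<close> gives the majorant \<open>(1 + k \<tau>)\<^sup>-\<^sup>\<alpha> / (1 + \<tau>)\<close>, uniformly in \<open>(x, t)\<close>. Its
  integral over \<open>\<tau> > 0\<close> is of order \<open>f\<^sub>p(k)\<close>; the three regimes are \<open>\<alpha> > 1\<close>, \<open>\<alpha> = 1\<close>, \<open>\<alpha> < 1\<close>.\<close>

section \<open>Measure-theoretic tools: completed measures, a split form of Hoelder's inequality,
  superposition in time\<close>

lemma sigma_finite_measure_completion:
  assumes "sigma_finite_measure M"
  shows "sigma_finite_measure (completion M)"
proof -
  interpret sigma_finite_measure M by fact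
  obtain A where A: "countable A" "A \<subseteq> sets M" "\<Union>A = space M" "\<forall>a\<in>A. emeasure M a \<noteq> \<infinity>"
    using sigma_finite_countable by blast
  show ?thesis
    by (rule sigma_finite_measure.intro, rule exI[of _ A]) (use A in \<open>auto simp: subset_iff\<close>)
qed

text \<open>The data are only Lebesgue measurable, so Tonelli's theorem is applied on the completed
  measure; a countable cover by sets of finite measure survives completion.\<close>

lemma sigma_finite_lebesgue: "sigma_finite_measure lebesgue"
  by (rule sigma_finite_measure_completion[OF sigma_finite_lborel])

text \<open>If \<open>f\<close> is not integrable, its Bochner integral is 0 by convention and the
  bound is trivial.\<close>

lemma norm_integral_le_nn_integral:
  fixes f :: "'a \<Rightarrow> 'b::{banach, second_countable_topology}"
  shows "ennreal (norm (integral\<^sup>L M f)) \<le> (\<integral>\<^sup>+x. ennreal (norm (f x)) \<partial>M)"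
  by (cases "integrable M f") (auto simp: integral_norm_bound_ennreal not_integrable_integral_eq)

text \<open>Optimising over \<open>l\<close> gives the Hoelder bound of an integral against \<open>g\<close>, in a form that
  covers \<open>p = 1\<close> and needs no conjugate exponent.\<close>
lemma nn_integral_mult_le_split:
  fixes g f :: "'a \<Rightarrow> real"
  assumes [measurable]: "g \<in> borel_measurable M" "f \<in> borel_measurable M"
    and g0: "\<And>y. 0 \<le> g y" and gS: "\<And>y. g y \<le> S"
    and B: "(\<integral>\<^sup>+y. ennreal (g y) \<partial>M) \<le> ennreal B"
    and A: "(\<integral>\<^sup>+y. ennreal (\<bar>f y\<bar> powr p) \<partial>M) \<le> ennreal A"
    and p: "1 \<le> p" and l: "0 < l" and nn: "0 \<le> A" "0 \<le> B"
  shows "(\<integral>\<^sup>+y. ennreal (g y * \<bar>f y\<bar>) \<partial>M) \<le> ennreal (l * B + l powr (1 - p) * S * A)"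
proof -
  have S: "0 \<le> S" using g0 gS order_trans by blast
  \<comment> \<open>Up to the level \<open>l\<close> the value is bounded by \<open>l\<close>
    itself; above it, \<open>1 - p \<le> 0\<close> makes \<open>\<bar>v\<bar> powr (1 - p)\<close>
    at most \<open>l powr (1 - p)\<close>.\<close>
  have pt: "\<bar>v\<bar> \<le> l + l powr (1 - p) * \<bar>v\<bar> powr p" for v :: real
  proof (cases "\<bar>v\<bar> \<le> l")
    case True
    then show ?thesis by (simp add: add_increasing2)
  next
    case False
    then have v: "\<bar>v\<bar> > l" by simp
    have "\<bar>v\<bar> = \<bar>v\<bar> powr (1 - p) * \<bar>v\<bar> powr p"
      using v l by (simp add: powr_add[symmetric])
    also have "\<dots> \<le> l powr (1 - p) * \<bar>v\<bar> powr p"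
      using v l p by (intro mult_right_mono powr_mono2') auto
    finally show ?thesis using l by linarith
  qed
  have "(\<integral>\<^sup>+y. ennreal (g y * \<bar>f y\<bar>) \<partial>M)
      \<le> (\<integral>\<^sup>+y. ennreal l * ennreal (g y) + ennreal (l powr (1 - p) * S) * ennreal (\<bar>f y\<bar> powr p) \<partial>M)"
  proof (rule nn_integral_mono)
    fix y
    have "g y * \<bar>f y\<bar> \<le> g y * (l + l powr (1 - p) * \<bar>f y\<bar> powr p)"
      by (intro mult_left_mono pt g0)
    also have "\<dots> = l * g y + g y * (l powr (1 - p) * \<bar>f y\<bar> powr p)"
      by (simp add: algebra_simps)
    also have "\<dots> \<le> l * g y + S * (l powr (1 - p) * \<bar>f y\<bar> powr p)"
      by (intro add_left_mono mult_right_mono gS) auto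
    finally have "ennreal (g y * \<bar>f y\<bar>) \<le> ennreal (l * g y + (l powr (1 - p) * S) * \<bar>f y\<bar> powr p)"
      by (intro ennreal_leI) (simp add: mult_ac)
    also have "\<dots> = ennreal l * ennreal (g y) + ennreal (l powr (1 - p) * S) * ennreal (\<bar>f y\<bar> powr p)"
      using l g0 S by (simp add: ennreal_plus ennreal_mult)
    finally show "ennreal (g y * \<bar>f y\<bar>) \<le> \<dots>" .
  qed
  also have "\<dots> = ennreal l * (\<integral>\<^sup>+y. ennreal (g y) \<partial>M)
      + ennreal (l powr (1 - p) * S) * (\<integral>\<^sup>+y. ennreal (\<bar>f y\<bar> powr p) \<partial>M)"
    by (simp add: nn_integral_add nn_integral_cmult)
  also have "\<dots> \<le> ennreal l * ennreal B + ennreal (l powr (1 - p) * S) * ennreal A"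
    by (intro add_mono mult_left_mono B A) auto
  also have "\<dots> = ennreal (l * B + l powr (1 - p) * S * A)"
    using l S nn by (simp add: ennreal_plus ennreal_mult)
  finally show ?thesis .
qed

text \<open>The inner integral is replaced by that of its absolute value, after which Tonelli
  exchanges the order and each time slice costs \<open>C * w \<tau>\<close>. One nonnegative
  estimate thus gives both the integrability and the bound. It is applied with \<open>h\<close> the
  integrand of \<open>Hk\<close>.\<close>

lemma integral_time_superposition:
  fixes h :: "real \<Rightarrow> 'b \<Rightarrow> real" and w :: "real \<Rightarrow> real"
  assumes M: "sigma_finite_measure M"
    and h [measurable]: "case_prod h \<in> borel_measurable (lborel \<Otimes>\<^sub>M M)"
    and f [measurable]: "f \<in> borel_measurable M"
    and [measurable]: "T \<in> sets borel" "w \<in> borel_measurable borel"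
    and hf: "\<And>\<tau>. \<tau> \<in> T \<Longrightarrow> (\<integral>\<^sup>+y. ennreal (\<bar>h \<tau> y\<bar> * \<bar>f y\<bar>) \<partial>M) \<le> ennreal C * ennreal (w \<tau>)"
    and W: "(\<integral>\<^sup>+\<tau>. ennreal (w \<tau>) * indicator T \<tau> \<partial>lborel) \<le> ennreal W"
    and nn: "0 \<le> C" "0 \<le> W"
  shows "integrable M (\<lambda>y. (LINT \<tau>:T|lborel. h \<tau> y) * f y)"
    and "\<bar>LINT y|M. (LINT \<tau>:T|lborel. h \<tau> y) * f y\<bar> \<le> C * W"
proof -
  interpret M: sigma_finite_measure M by fact
  interpret pair_sigma_finite lborel M ..
  let ?H = "\<lambda>y. LINT \<tau>:T|lborel. h \<tau> y"
  have [measurable]: "case_prod h \<in> borel_measurable (borel \<Otimes>\<^sub>M M)"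
    using h by simp
  have [measurable]: "?H \<in> borel_measurable M"
    unfolding set_lebesgue_integral_def by measurable
  have "(\<integral>\<^sup>+y. ennreal (norm (?H y * f y)) \<partial>M)
      \<le> (\<integral>\<^sup>+y. (\<integral>\<^sup>+\<tau>. ennreal (\<bar>h \<tau> y\<bar> * \<bar>f y\<bar>) * indicator T \<tau> \<partial>lborel) \<partial>M)"
  proof (rule nn_integral_mono)
    fix y assume "y \<in> space M"
    then have [measurable]: "(\<lambda>\<tau>. h \<tau> y) \<in> borel_measurable borel" by measurable
    have "ennreal (norm (?H y * f y)) = ennreal (norm (?H y)) * ennreal \<bar>f y\<bar>"
      by (simp add: abs_mult ennreal_mult)
    also have "\<dots> \<le> (\<integral>\<^sup>+\<tau>. ennreal (norm (indicator T \<tau> *\<^sub>R h \<tau> y)) \<partial>lborel) * ennreal \<bar>f y\<bar>"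
      unfolding set_lebesgue_integral_def by (intro mult_right_mono norm_integral_le_nn_integral) auto
    also have "\<dots> = (\<integral>\<^sup>+\<tau>. ennreal (norm (indicator T \<tau> *\<^sub>R h \<tau> y)) * ennreal \<bar>f y\<bar> \<partial>lborel)"
      by (intro nn_integral_multc[symmetric]) measurable
    also have "\<dots> = (\<integral>\<^sup>+\<tau>. ennreal (\<bar>h \<tau> y\<bar> * \<bar>f y\<bar>) * indicator T \<tau> \<partial>lborel)"
      by (intro nn_integral_cong) (auto simp: ennreal_mult split: split_indicator)
    finally show "ennreal (norm (?H y * f y)) \<le> \<dots>" .
  qed
  also have "\<dots> = (\<integral>\<^sup>+\<tau>. (\<integral>\<^sup>+y. ennreal (\<bar>h \<tau> y\<bar> * \<bar>f y\<bar>) * indicator T \<tau> \<partial>M) \<partial>lborel)"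
    by (rule Fubini') measurable
  also have "\<dots> \<le> (\<integral>\<^sup>+\<tau>. ennreal C * (ennreal (w \<tau>) * indicator T \<tau>) \<partial>lborel)"
    by (intro nn_integral_mono) (auto simp: hf split: split_indicator)
  also have "\<dots> = ennreal C * (\<integral>\<^sup>+\<tau>. ennreal (w \<tau>) * indicator T \<tau> \<partial>lborel)"
    by (rule nn_integral_cmult) measurable
  also have "\<dots> \<le> ennreal C * ennreal W"
    by (intro mult_left_mono W) auto
  finally have *: "(\<integral>\<^sup>+y. ennreal (norm (?H y * f y)) \<partial>M) \<le> ennreal (C * W)"
    using nn by (simp add: ennreal_mult)
  show "integrable M (\<lambda>y. ?H y * f y)"
    by (rule integrableI_bounded) (use * in \<open>auto intro: le_less_trans\<close>)
  have "ennreal \<bar>LINT y|M. ?H y * f y\<bar> \<le> ennreal (C * W)"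
    using order_trans[OF norm_integral_le_nn_integral *] by simp
  then show "\<bar>LINT y|M. ?H y * f y\<bar> \<le> C * W"
    using nn by (simp add: ennreal_le_iff)
qed

section \<open>A majorant for the time dependence of the boundary kernel\<close>

text \<open>This is \<open>1 + u \<le> exp u\<close> at \<open>u = v / (8 * m)\<close>, raised to
  the power \<open>m\<close>. The 8 is the one in the Gaussian factor
  \<open>exp (- a^2 / (8 * s))\<close>.\<close>

lemma exp_minus_le_powr:
  fixes v m :: real
  assumes v: "0 \<le> v" and m: "0 < m"
  shows "exp (- v / 8) \<le> (1 + 8 * m) powr m * (1 + v) powr (- m)"
proof -
  define u where "u = v / (8 * m)"
  have u: "0 \<le> u" "v = 8 * m * u" using v m by (simp_all add: u_def)
  have "1 + v \<le> (1 + 8 * m) * (1 + u)" using u m by (simp add: algebra_simps)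
  also have "\<dots> \<le> (1 + 8 * m) * exp u"
    using m by (intro mult_left_mono exp_ge_add_one_self) auto
  finally have "(1 + v) powr m \<le> ((1 + 8 * m) * exp u) powr m"
    using v m by (intro powr_mono2) auto
  also have "\<dots> = (1 + 8 * m) powr m * exp (v / 8)"
    using m u by (simp add: powr_mult exp_powr_real mult_ac)
  finally have "(1 + v) powr m * exp (- v / 8) \<le> (1 + 8 * m) powr m * exp (v / 8) * exp (- v / 8)"
    by (intro mult_right_mono) auto
  then have "(1 + v) powr m * exp (- v / 8) \<le> (1 + 8 * m) powr m"
    by (simp add: mult.assoc exp_add[symmetric])
  then show ?thesis
    using v by (simp add: powr_minus field_simps)
qed

text \<open>The exponential turns the factor \<open>s\<close> into \<open>s + a\<^sup>2\<close>, which is bounded away from 0 because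
  \<open>x\<^sub>N + t > R\<close>; this removes the singularity at \<open>s = 0\<close> and supplies the decay in \<open>\<tau>\<close>.\<close>
lemma kernel_time_weight_bound:
  fixes \<epsilon> \<delta> R \<alpha> \<beta> :: real
  assumes e: "0 < \<epsilon>" and d: "0 < \<delta>" and R: "0 < R" and al: "0 < \<alpha>" and be: "1 / 2 \<le> \<beta>"
  obtains C where "0 \<le> C"
    "\<And>k xN t \<tau> s a. \<lbrakk>0 < k; 0 \<le> xN; R < xN + t; 0 < \<tau>; \<tau> < t; s = (t - \<tau>) / \<epsilon>; a = xN + \<tau> / \<delta>\<rbrakk> \<Longrightarrow>
      (s + k / \<delta> * \<tau>) powr (- \<alpha>) * s powr (- \<beta>) * exp (- a\<^sup>2 / (8 * s))
        \<le> C * ((1 + k * \<tau>) powr (- \<alpha>) * (1 + \<tau>) powr (- 1))"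
proof -
  \<comment> \<open>With \<open>v = xN + \<tau>\<close>, \<open>c0\<close> compares
    \<open>s + a^2\<close> with \<open>(t - \<tau>) + v^2\<close>, and \<open>c1\<close> is a lower
    bound for the latter in terms of \<open>R\<close>. Then \<open>c2 * (1 + \<tau>)^2\<close>
    bounds \<open>s + a^2\<close> from below, and \<open>c3\<close> serves for
    \<open>(s + k / \<delta> * \<tau>) * (s + a^2) / s\<close>. \<open>D\<close> is the constant of
    \<open>exp_minus_le_powr\<close> at \<open>m = \<alpha> + \<beta>\<close>.\<close>
  define c0 where "c0 = min (1 / \<epsilon>) ((min 1 (1 / \<delta>))\<^sup>2)"
  define c1 where "c1 = min (R / 2) ((R / 2)\<^sup>2)"
  define c2 where "c2 = c0 * min c1 1 / 4"
  define c3 where "c3 = min c2 (c2 / \<delta>)"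
  define D where "D = (1 + 8 * (\<alpha> + \<beta>)) powr (\<alpha> + \<beta>)"
  define C where "C = D * c3 powr (- \<alpha>) * c2 powr (- \<beta>)"
  have c0: "0 < c0" "c0 \<le> 1 / \<epsilon>" "c0 \<le> 1" "c0 \<le> (min 1 (1 / \<delta>))\<^sup>2"
  proof -
    have "0 < (min 1 (1 / \<delta>))\<^sup>2" "(min 1 (1 / \<delta>))\<^sup>2 \<le> 1" using d by (auto simp: min_def intro!: power_le_one zero_less_power)
    then show "0 < c0" "c0 \<le> 1 / \<epsilon>" "c0 \<le> 1" "c0 \<le> (min 1 (1 / \<delta>))\<^sup>2"
      using e by (auto simp: c0_def)
  qed
  have c1: "0 < c1" using R by (simp add: c1_def)
  have c2: "0 < c2" using c0 c1 by (simp add: c2_def)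
  have c3: "0 < c3" "c3 \<le> c2" "c3 \<le> c2 / \<delta>" using c2 d by (simp_all add: c3_def)
  show ?thesis
  proof (rule that[of C])
    show "0 \<le> C" by (simp add: C_def D_def)
    fix k xN t \<tau> s a :: real
    assume k: "0 < k" and x: "0 \<le> xN" and xt: "R < xN + t" and tau: "0 < \<tau>" "\<tau> < t"
      and s: "s = (t - \<tau>) / \<epsilon>" and a: "a = xN + \<tau> / \<delta>"
    define v where "v = xN + \<tau>"
    have s0: "0 < s" using s tau e by simp
    have a0: "0 < a" using a tau x d by (simp add: add_nonneg_pos)
    have v0: "0 < v" using v_def x tau by simp
    have "c0 * (t - \<tau>) \<le> s"
      using mult_right_mono[OF c0(2), of "t - \<tau>"] tau s by simp
    moreover have "c0 * v\<^sup>2 \<le> a\<^sup>2"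
    proof -
      have "min 1 (1 / \<delta>) * v \<le> a"
      proof -
        have "min 1 (1 / \<delta>) * xN \<le> 1 * xN" "min 1 (1 / \<delta>) * \<tau> \<le> (1 / \<delta>) * \<tau>"
          using x tau by (intro mult_right_mono; simp)+
        then show ?thesis by (simp add: a v_def algebra_simps)
      qed
      then have "(min 1 (1 / \<delta>) * v)\<^sup>2 \<le> a\<^sup>2"
        using d v0 by (intro power_mono) auto
      moreover have "c0 * v\<^sup>2 \<le> (min 1 (1 / \<delta>))\<^sup>2 * v\<^sup>2"
        by (intro mult_right_mono c0) auto
      ultimately show ?thesis by (simp add: power_mult_distrib)
    qed
    ultimately have sa: "c0 * ((t - \<tau>) + v\<^sup>2) \<le> s + a\<^sup>2" by (simp add: algebra_simps)
    \<comment> \<open>Since \<open>v + (t - \<tau>) = xN + t > R\<close>, one of the two summands is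
      at least \<open>R / 2\<close>.\<close>
    have w1: "c1 \<le> (t - \<tau>) + v\<^sup>2"
    proof (cases "R / 2 \<le> v")
      case True
      then have "(R / 2)\<^sup>2 \<le> v\<^sup>2" using R by (intro power_mono) auto
      then show ?thesis using tau by (simp add: c1_def min_def)
    next
      case False
      then have "R / 2 \<le> t - \<tau>" using xt by (simp add: v_def)
      then show ?thesis by (simp add: c1_def min_def add_increasing2)
    qed
    have w2: "\<tau>\<^sup>2 \<le> (t - \<tau>) + v\<^sup>2"
    proof -
      have "\<tau>\<^sup>2 \<le> v\<^sup>2" using tau x by (intro power_mono) (auto simp: v_def)
      then show ?thesis using tau by simp
    qed
    have sq: "(1 + \<tau>)\<^sup>2 \<le> 2 * (1 + \<tau>\<^sup>2)"
      using zero_le_power2[of "1 - \<tau>"] by (simp add: power2_eq_square algebra_simps)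
    have "min c1 1 * (1 + \<tau>\<^sup>2) \<le> 2 * ((t - \<tau>) + v\<^sup>2)"
    proof -
      have "min c1 1 * 1 \<le> (t - \<tau>) + v\<^sup>2" using w1 by simp
      moreover have "min c1 1 * \<tau>\<^sup>2 \<le> 1 * \<tau>\<^sup>2" by (intro mult_right_mono) auto
      ultimately show ?thesis using w2 by (simp add: distrib_left)
    qed
    moreover have "min c1 1 * (1 + \<tau>)\<^sup>2 \<le> min c1 1 * (2 * (1 + \<tau>\<^sup>2))"
      using c1 by (intro mult_left_mono sq) auto
    moreover have "min c1 1 * (2 * (1 + \<tau>\<^sup>2)) = 2 * (min c1 1 * (1 + \<tau>\<^sup>2))" by simp
    ultimately have "min c1 1 * (1 + \<tau>)\<^sup>2 \<le> 4 * ((t - \<tau>) + v\<^sup>2)" by linarith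
    then have "c2 * (1 + \<tau>)\<^sup>2 \<le> c0 * ((t - \<tau>) + v\<^sup>2)"
      using mult_left_mono[of "min c1 1 * (1 + \<tau>)\<^sup>2" _ "c0 / 4"] c0 by (simp add: c2_def mult_ac)
    then have lo: "c2 * (1 + \<tau>)\<^sup>2 \<le> s + a\<^sup>2" using sa by linarith
    have one: "1 \<le> (1 + \<tau>)\<^sup>2" using tau by (simp add: power2_eq_square algebra_simps)
    then have lo1: "c2 \<le> s + a\<^sup>2"
      using order_trans[OF mult_left_mono[OF one less_imp_le[OF c2]] lo] by simp
    \<comment> \<open>The right side expands to
      \<open>(s + a^2) + (k / \<delta> * \<tau>) * ((s + a^2) / s)\<close>. The first term is at
      least \<open>c2\<close>; in the second the quotient is at least 1, hence at least
      \<open>c2\<close>.\<close>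
    have sig: "c3 * (1 + k * \<tau>) \<le> (s + k / \<delta> * \<tau>) * (s + a\<^sup>2) / s"
    proof -
      have "c2 * 1 \<le> s + a\<^sup>2" using lo1 by simp
      moreover have "k * \<tau> * (c2 / \<delta>) \<le> (k / \<delta> * \<tau>) * ((s + a\<^sup>2) / s)"
      proof -
        have "(k / \<delta> * \<tau>) * c2 \<le> (k / \<delta> * \<tau>) * ((s + a\<^sup>2) / s)" if "c2 \<le> (s + a\<^sup>2) / s"
          using that k d tau by (intro mult_left_mono) auto
        moreover have "c2 \<le> 1"
        proof -
          have "c0 * min c1 1 \<le> 1" using c0 c1 by (intro mult_le_one) auto
          then show ?thesis by (simp add: c2_def)
        qed
        moreover have "1 \<le> (s + a\<^sup>2) / s" using s0 by simp
        ultimately show ?thesis by simp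
      qed
      moreover have "(s + k / \<delta> * \<tau>) * (s + a\<^sup>2) / s = (s + a\<^sup>2) + (k / \<delta> * \<tau>) * ((s + a\<^sup>2) / s)"
      proof -
        have "(s + K) * Q / s = Q + K * (Q / s)" for K Q
          using s0 by (simp add: distrib_right add_divide_distrib)
        then show ?thesis .
      qed
      moreover have "c3 * (1 + k * \<tau>) \<le> c2 + k * \<tau> * (c2 / \<delta>)"
        using c3(2) mult_right_mono[OF c3(3), of "k * \<tau>"] k tau by (simp add: algebra_simps)
      ultimately show ?thesis by linarith
    qed
    define P where "P = s + a\<^sup>2"
    define sg where "sg = s + k / \<delta> * \<tau>"
    have P0: "0 < P" using s0 by (simp add: P_def add_pos_nonneg)
    have sg0: "0 < sg" using s0 k d tau by (simp add: sg_def add_pos_pos)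
    \<comment> \<open>The exponent \<open>\<alpha> + \<beta>\<close> is chosen so that, after
      expanding \<open>P / s\<close>, the factor \<open>s powr \<beta>\<close> cancels
      \<open>s powr (- \<beta>)\<close> and \<open>s powr \<alpha>\<close> turns
      \<open>sg powr (- \<alpha>)\<close> into a power of \<open>sg * P / s\<close>. Then
      \<open>sig\<close> and \<open>lo\<close> apply.\<close>
    have "exp (- a\<^sup>2 / (8 * s)) \<le> D * (1 + a\<^sup>2 / s) powr (- (\<alpha> + \<beta>))"
      using exp_minus_le_powr[of "a\<^sup>2 / s" "\<alpha> + \<beta>"] al be s0 by (simp add: D_def mult_ac)
    also have "1 + a\<^sup>2 / s = P / s" using s0 by (simp add: P_def field_simps)
    finally have "sg powr (- \<alpha>) * s powr (- \<beta>) * exp (- a\<^sup>2 / (8 * s))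
        \<le> sg powr (- \<alpha>) * s powr (- \<beta>) * (D * (P / s) powr (- (\<alpha> + \<beta>)))"
      by (intro mult_left_mono) auto
    also have "\<dots> = D * (sg * P / s) powr (- \<alpha>) * P powr (- \<beta>)"
    proof -
      have "(P / s) powr (- (\<alpha> + \<beta>)) = P powr (- \<alpha>) * P powr (- \<beta>) * (s powr \<alpha> * s powr \<beta>)"
      proof -
        have "(P / s) powr (- (\<alpha> + \<beta>)) = P powr (- (\<alpha> + \<beta>)) * s powr (\<alpha> + \<beta>)"
          using powr_divide[of P s "- (\<alpha> + \<beta>)"] s0 P0
          by (simp only: powr_minus divide_inverse inverse_inverse_eq less_imp_le)
        also have "P powr (- (\<alpha> + \<beta>)) = P powr (- \<alpha>) * P powr (- \<beta>)"
          by (simp flip: powr_add)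
        finally show ?thesis by (simp only: powr_add)
      qed
      moreover have "(sg * P / s) powr (- \<alpha>) = sg powr (- \<alpha>) * P powr (- \<alpha>) * s powr \<alpha>"
        using s0 P0 sg0 by (simp add: powr_divide powr_mult powr_minus_divide)
      moreover have "s powr (- \<beta>) * s powr \<beta> = 1" using s0 by (simp flip: powr_add)
      ultimately show ?thesis by (simp add: mult_ac)
    qed
    also have "\<dots> \<le> D * (c3 * (1 + k * \<tau>)) powr (- \<alpha>) * (c2 * (1 + \<tau>)\<^sup>2) powr (- \<beta>)"
      using sig lo c3 c2 k tau al be
      by (intro mult_mono powr_mono2' mult_pos_pos zero_less_power) (auto simp: D_def P_def sg_def add_pos_pos)
    also have "\<dots> = C * ((1 + k * \<tau>) powr (- \<alpha>) * (1 + \<tau>) powr (- (2 * \<beta>)))"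
    proof -
      have "((1 + \<tau>)\<^sup>2) powr (- \<beta>) = (1 + \<tau>) powr (- (2 * \<beta>))"
        using tau by (simp add: powr_numeral[symmetric] powr_powr del: powr_numeral)
      then show ?thesis
        using c3 c2 k tau by (simp add: C_def powr_mult)
    qed
    \<comment> \<open>The assumption \<open>1 / 2 \<le> \<beta>\<close> means
      \<open>2 * \<beta> \<ge> 1\<close>, so one common decay rate serves for all such
      \<beta>.\<close>
    also have "\<dots> \<le> C * ((1 + k * \<tau>) powr (- \<alpha>) * (1 + \<tau>) powr (- 1))"
      using tau be \<open>0 \<le> C\<close> by (intro mult_left_mono powr_mono) auto
    finally show "(s + k / \<delta> * \<tau>) powr (- \<alpha>) * s powr (- \<beta>) * exp (- a\<^sup>2 / (8 * s))
        \<le> C * ((1 + k * \<tau>) powr (- \<alpha>) * (1 + \<tau>) powr (- 1))" by (simp add: sg_def)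
  qed
qed

section \<open>The time integral of the majorant in the three regimes\<close>

lemma DERIV_affine_powr:
  fixes \<alpha> k \<tau> :: real
  assumes "\<alpha> \<noteq> 1" "k \<noteq> 0" and pos: "0 < 1 + k * \<tau>"
  shows "((\<lambda>\<tau>. (1 + k * \<tau>) powr (1 - \<alpha>) / (k * (1 - \<alpha>))) has_real_derivative (1 + k * \<tau>) powr (- \<alpha>)) (at \<tau>)"
proof -
  have "((\<lambda>\<tau>. (1 + k * \<tau>) powr (1 - \<alpha>) / (k * (1 - \<alpha>))) has_real_derivative
      ((1 - \<alpha>) * (1 + k * \<tau>) powr (1 - \<alpha> - 1) * k) / (k * (1 - \<alpha>))) (at \<tau>)"
    using pos by (intro DERIV_cdivide DERIV_fun_powr[where g = "\<lambda>\<tau>. 1 + k * \<tau>", THEN DERIV_cong])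
      (auto intro!: derivative_eq_intros)
  then show ?thesis using assms by simp
qed

text \<open>For \<open>\<alpha> > 1\<close> the first factor is integrable on its own, so the second
  is bounded by 1 and dropped.\<close>

lemma nn_integral_weight_gt1:
  fixes \<alpha> k :: real
  assumes al: "1 < \<alpha>" and k: "0 < k"
  shows "(\<integral>\<^sup>+\<tau>. ennreal ((1 + k * \<tau>) powr (- \<alpha>) * (1 + \<tau>) powr (- 1)) * indicator {0..} \<tau> \<partial>lborel)
    \<le> ennreal (1 / (\<alpha> - 1) * (1 / k))"
proof -
  have lim: "((\<lambda>\<tau>. (1 + k * \<tau>) powr (1 - \<alpha>) / (k * (1 - \<alpha>))) \<longlongrightarrow> 0) at_top"
    using al k by real_asymp
  have "(\<integral>\<^sup>+\<tau>. ennreal ((1 + k * \<tau>) powr (- \<alpha>) * (1 + \<tau>) powr (- 1)) * indicator {0..} \<tau> \<partial>lborel)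
      \<le> (\<integral>\<^sup>+\<tau>. ennreal ((1 + k * \<tau>) powr (- \<alpha>)) * indicator {0..} \<tau> \<partial>lborel)"
  proof (intro nn_integral_mono)
    fix \<tau> :: real
    have "(1 + k * \<tau>) powr (- \<alpha>) * (1 + \<tau>) powr (- 1) \<le> (1 + k * \<tau>) powr (- \<alpha>) * 1" if "0 \<le> \<tau>"
      using that by (intro mult_left_mono) (auto simp: powr_minus field_simps)
    then show "ennreal ((1 + k * \<tau>) powr (- \<alpha>) * (1 + \<tau>) powr (- 1)) * indicator {0..} \<tau>
      \<le> ennreal ((1 + k * \<tau>) powr (- \<alpha>)) * indicator {0..} \<tau>"
      by (auto split: split_indicator intro: ennreal_leI)
  qed
  also have "\<dots> = ennreal (0 - (1 + k * 0) powr (1 - \<alpha>) / (k * (1 - \<alpha>)))"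
  proof (rule nn_integral_FTC_atLeast)
    fix \<tau> :: real assume "0 \<le> \<tau>"
    then have "0 < 1 + k * \<tau>" using k by (simp add: add_pos_nonneg)
    then show "((\<lambda>\<tau>. (1 + k * \<tau>) powr (1 - \<alpha>) / (k * (1 - \<alpha>))) has_real_derivative (1 + k * \<tau>) powr (- \<alpha>)) (at \<tau>)"
      using al k by (intro DERIV_affine_powr) auto
  qed (use lim in auto)
  also have "0 - (1 + k * 0) powr (1 - \<alpha>) / (k * (1 - \<alpha>)) = 1 / (\<alpha> - 1) * (1 / k)"
    using al k by (simp add: field_simps)
  finally show ?thesis .
qed

text \<open>Partial fractions give the exact value \<open>ln k / (k - 1)\<close>, the limit coming
  from \<open>(1 + k * \<tau>) / (1 + \<tau>)\<close> tending to \<open>k\<close>. The factor 2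
  comes from \<open>k - 1 \<ge> k / 2\<close>, which is \<open>k \<ge> 2\<close>.\<close>

lemma nn_integral_weight_eq1:
  fixes k :: real
  assumes k: "2 \<le> k"
  shows "(\<integral>\<^sup>+\<tau>. ennreal ((1 + k * \<tau>) powr (- 1) * (1 + \<tau>) powr (- 1)) * indicator {0..} \<tau> \<partial>lborel)
    \<le> ennreal (2 * (ln k / k))"
proof -
  have lim: "((\<lambda>\<tau>. (ln (1 + k * \<tau>) - ln (1 + \<tau>)) / (k - 1)) \<longlongrightarrow> ln k / (k - 1)) at_top"
    using k by real_asymp (simp add: divide_inverse)
  have "(\<integral>\<^sup>+\<tau>. ennreal ((1 + k * \<tau>) powr (- 1) * (1 + \<tau>) powr (- 1)) * indicator {0..} \<tau> \<partial>lborel)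
      = ennreal (ln k / (k - 1) - (ln (1 + k * 0) - ln (1 + 0)) / (k - 1))"
  proof (rule nn_integral_FTC_atLeast)
    fix \<tau> :: real assume "0 \<le> \<tau>"
    then have pos: "0 < 1 + k * \<tau>" "0 < 1 + \<tau>" using k by (simp_all add: add_pos_nonneg)
    have "((\<lambda>\<tau>. (ln (1 + k * \<tau>) - ln (1 + \<tau>)) / (k - 1)) has_real_derivative
        (k / (1 + k * \<tau>) - 1 / (1 + \<tau>)) / (k - 1)) (at \<tau>)"
      using pos by (intro DERIV_cdivide DERIV_diff) (auto intro!: derivative_eq_intros)
    moreover have "(k / (1 + k * \<tau>) - 1 / (1 + \<tau>)) / (k - 1) = (1 + k * \<tau>) powr (- 1) * (1 + \<tau>) powr (- 1)"
      using pos k by (simp add: powr_minus_divide divide_simps) (simp add: algebra_simps)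
    ultimately show "((\<lambda>\<tau>. (ln (1 + k * \<tau>) - ln (1 + \<tau>)) / (k - 1)) has_real_derivative
        (1 + k * \<tau>) powr (- 1) * (1 + \<tau>) powr (- 1)) (at \<tau>)" by simp
  qed (use lim in auto)
  also have "\<dots> \<le> ennreal (2 * (ln k / k))"
  proof (rule ennreal_leI)
    have "ln k * (1 / (k - 1)) \<le> ln k * (2 / k)"
      using k by (intro mult_left_mono) (auto simp: field_simps)
    then show "ln k / (k - 1) - (ln (1 + k * 0) - ln (1 + 0)) / (k - 1) \<le> 2 * (ln k / k)" by (simp add: mult.commute)
  qed
  finally show ?thesis .
qed

text \<open>Neither factor is integrable alone, so the half line is cut at 1. Up to 1 the second
  factor is dropped; beyond 1 both summands 1 are dropped, leaving the integrable
  \<open>\<tau> powr (- \<alpha> - 1)\<close> times \<open>k powr (- \<alpha>)\<close>.\<close>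

lemma nn_integral_weight_lt1:
  fixes \<alpha> k :: real
  assumes al: "0 < \<alpha>" "\<alpha> < 1" and k: "1 \<le> k"
  shows "(\<integral>\<^sup>+\<tau>. ennreal ((1 + k * \<tau>) powr (- \<alpha>) * (1 + \<tau>) powr (- 1)) * indicator {0..} \<tau> \<partial>lborel)
    \<le> ennreal ((2 / (1 - \<alpha>) + 1 / \<alpha>) * k powr (- \<alpha>))"
proof -
  have lim: "((\<lambda>\<tau>. k powr (- \<alpha>) * (\<tau> powr (- \<alpha>) / (- \<alpha>))) \<longlongrightarrow> 0) at_top"
    using al k by real_asymp
  have "(\<integral>\<^sup>+\<tau>. ennreal ((1 + k * \<tau>) powr (- \<alpha>) * (1 + \<tau>) powr (- 1)) * indicator {0..} \<tau> \<partial>lborel)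
      \<le> (\<integral>\<^sup>+\<tau>. ennreal ((1 + k * \<tau>) powr (- \<alpha>)) * indicator {0..1} \<tau>
          + ennreal (k powr (- \<alpha>) * \<tau> powr (- \<alpha> - 1)) * indicator {1..} \<tau> \<partial>lborel)"
  proof (intro nn_integral_mono)
    fix \<tau> :: real
    have "(1 + k * \<tau>) powr (- \<alpha>) * (1 + \<tau>) powr (- 1) \<le> (1 + k * \<tau>) powr (- \<alpha>) * 1" if "0 \<le> \<tau>"
      using that by (intro mult_left_mono) (auto simp: powr_minus field_simps)
    moreover have "(1 + k * \<tau>) powr (- \<alpha>) * (1 + \<tau>) powr (- 1) \<le> k powr (- \<alpha>) * \<tau> powr (- \<alpha> - 1)" if "1 \<le> \<tau>"
    proof -
      have "(1 + k * \<tau>) powr (- \<alpha>) * (1 + \<tau>) powr (- 1) \<le> (k * \<tau>) powr (- \<alpha>) * \<tau> powr (- 1)"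
        using that al k by (intro mult_mono powr_mono2' mult_pos_pos) auto
      also have "\<dots> = k powr (- \<alpha>) * \<tau> powr (- \<alpha> - 1)"
        using that k by (simp add: powr_mult powr_diff powr_minus field_simps)
      finally show ?thesis .
    qed
    ultimately show "ennreal ((1 + k * \<tau>) powr (- \<alpha>) * (1 + \<tau>) powr (- 1)) * indicator {0..} \<tau>
      \<le> ennreal ((1 + k * \<tau>) powr (- \<alpha>)) * indicator {0..1} \<tau>
          + ennreal (k powr (- \<alpha>) * \<tau> powr (- \<alpha> - 1)) * indicator {1..} \<tau>"
      by (cases "\<tau> \<le> 1"; cases "1 \<le> \<tau>") (auto split: split_indicator intro!: ennreal_leI add_increasing)
  qed
  also have "\<dots> = (\<integral>\<^sup>+\<tau>. ennreal ((1 + k * \<tau>) powr (- \<alpha>)) * indicator {0..1} \<tau> \<partial>lborel)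
      + (\<integral>\<^sup>+\<tau>. ennreal (k powr (- \<alpha>) * \<tau> powr (- \<alpha> - 1)) * indicator {1..} \<tau> \<partial>lborel)"
    by (rule nn_integral_add) auto
  also have "(\<integral>\<^sup>+\<tau>. ennreal ((1 + k * \<tau>) powr (- \<alpha>)) * indicator {0..1} \<tau> \<partial>lborel)
      = ennreal ((1 + k * 1) powr (1 - \<alpha>) / (k * (1 - \<alpha>)) - (1 + k * 0) powr (1 - \<alpha>) / (k * (1 - \<alpha>)))"
  proof (rule nn_integral_FTC_Icc)
    fix \<tau> :: real assume "\<tau> \<in> {0..1}"
    then have "0 < 1 + k * \<tau>" using k by (simp add: add_pos_nonneg)
    then show "((\<lambda>\<tau>. (1 + k * \<tau>) powr (1 - \<alpha>) / (k * (1 - \<alpha>))) has_real_derivative (1 + k * \<tau>) powr (- \<alpha>)) (at \<tau>)"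
      using al k by (intro DERIV_affine_powr) auto
  qed auto
  also have "(\<integral>\<^sup>+\<tau>. ennreal (k powr (- \<alpha>) * \<tau> powr (- \<alpha> - 1)) * indicator {1..} \<tau> \<partial>lborel)
      = ennreal (0 - k powr (- \<alpha>) * (1 powr (- \<alpha>) / (- \<alpha>)))"
  proof (rule nn_integral_FTC_atLeast)
    fix \<tau> :: real assume "1 \<le> \<tau>"
    then show "((\<lambda>\<tau>. k powr (- \<alpha>) * (\<tau> powr (- \<alpha>) / (- \<alpha>))) has_real_derivative k powr (- \<alpha>) * \<tau> powr (- \<alpha> - 1)) (at \<tau>)"
      using al k by (auto intro!: derivative_eq_intros)
  qed (use lim in auto)
  also have "ennreal ((1 + k * 1) powr (1 - \<alpha>) / (k * (1 - \<alpha>)) - (1 + k * 0) powr (1 - \<alpha>) / (k * (1 - \<alpha>)))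
      + ennreal (0 - k powr (- \<alpha>) * (1 powr (- \<alpha>) / (- \<alpha>)))
      \<le> ennreal (2 / (1 - \<alpha>) * k powr (- \<alpha>)) + ennreal (1 / \<alpha> * k powr (- \<alpha>))"
  proof (intro add_mono ennreal_leI)
    \<comment> \<open>From \<open>1 + k \<le> 2 * k\<close> and
      \<open>2 powr (1 - \<alpha>) \<le> 2\<close>; the value at 0 is subtracted and can be
      discarded.\<close>
    have "(1 + k) powr (1 - \<alpha>) \<le> (2 * k) powr (1 - \<alpha>)" using k al by (intro powr_mono2) auto
    also have "\<dots> = 2 powr (1 - \<alpha>) * k powr (1 - \<alpha>)" using k by (simp add: powr_mult)
    also have "\<dots> \<le> 2 powr 1 * k powr (1 - \<alpha>)" using al by (intro mult_right_mono powr_mono) auto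
    also have "\<dots> = 2 * k * k powr (- \<alpha>)" using k by (simp add: powr_diff powr_minus field_simps)
    finally have "(1 + k) powr (1 - \<alpha>) / (k * (1 - \<alpha>)) \<le> 2 * k * k powr (- \<alpha>) / (k * (1 - \<alpha>))"
      using k al by (intro divide_right_mono) auto
    moreover have "0 \<le> 1 / (k * (1 - \<alpha>))" using k al by auto
    ultimately have "(1 + k) powr (1 - \<alpha>) / (k * (1 - \<alpha>)) - 1 / (k * (1 - \<alpha>)) \<le> 2 * k * k powr (- \<alpha>) / (k * (1 - \<alpha>))"
      by linarith
    then show "(1 + k * 1) powr (1 - \<alpha>) / (k * (1 - \<alpha>)) - (1 + k * 0) powr (1 - \<alpha>) / (k * (1 - \<alpha>))
        \<le> 2 / (1 - \<alpha>) * k powr (- \<alpha>)"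
      using k by simp
  qed (use al in auto)
  also have "\<dots> = ennreal ((2 / (1 - \<alpha>) + 1 / \<alpha>) * k powr (- \<alpha>))"
    using al by (simp add: distrib_right flip: ennreal_plus)
  finally show ?thesis .
qed

text \<open>The position of \<open>p\<close> relative to \<open>n / 2\<close> is that of 1 relative
  to \<alpha>, which matches the branches of \<open>f_p\<close> with the three integrals.\<close>

lemma nn_integral_weight_f_p:
  fixes p :: real
  assumes p: "1 \<le> p" and n: "0 < n" and al: "\<alpha> = real n / (2 * p)"
  obtains C where "0 \<le> C" "\<And>k. 2 \<le> k \<Longrightarrow>
    (\<integral>\<^sup>+\<tau>. ennreal ((1 + k * \<tau>) powr (- \<alpha>) * (1 + \<tau>) powr (- 1)) * indicator {0..} \<tau> \<partial>lborel)
      \<le> ennreal (C * f_p p n k)"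
proof -
  consider "p < real n / 2" | "p = real n / 2" | "p > real n / 2" by linarith
  then show ?thesis
  proof cases
    case 1
    then have "1 < \<alpha>" using p by (simp add: al field_simps)
    then show ?thesis using 1 nn_integral_weight_gt1 by (intro that[of "1 / (\<alpha> - 1)"]) (auto simp: f_p_def)
  next
    case 2
    then have "\<alpha> = 1" using p by (simp add: al field_simps)
    then show ?thesis using 2 nn_integral_weight_eq1 by (intro that[of 2]) (auto simp: f_p_def)
  next
    case 3
    then have a: "\<alpha> < 1" "0 < \<alpha>" using p n by (simp_all add: al field_simps)
    then show ?thesis using 3 nn_integral_weight_lt1[OF a(2,1)]
      by (intro that[of "2 / (1 - \<alpha>) + 1 / \<alpha>"]) (auto simp: f_p_def al)
  qed
qed

section \<open>Heat kernels: size, total mass, normal derivative\<close>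

lemma borel_measurable_heat_kernel [measurable (raw)]:
  fixes f :: "'c \<Rightarrow> 'b::{real_normed_vector, second_countable_topology}"
  assumes [measurable]: "f \<in> borel_measurable M" "g \<in> borel_measurable M"
  shows "(\<lambda>x. heat_kernel d (f x) (g x)) \<in> borel_measurable M"
  unfolding heat_kernel_def by measurable

lemma heat_kernel_nonneg [simp]: "0 \<le> heat_kernel d z s"
  by (simp add: heat_kernel_def)

lemma heat_kernel_le_powr:
  assumes "0 < s"
  shows "heat_kernel d z s \<le> s powr (- (real d / 2))"
proof -
  have "1 * s \<le> 4 * pi * s" using assms pi_gt3 by (intro mult_right_mono) auto
  then have "(4 * pi * s) powr (- (real d / 2)) \<le> s powr (- (real d / 2))"
    using assms by (intro powr_mono2') auto
  moreover have "exp (- (norm z)\<^sup>2 / (4 * s)) \<le> 1" using assms by simp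
  ultimately have "heat_kernel d z s \<le> s powr (- (real d / 2)) * 1"
    unfolding heat_kernel_def by (intro mult_mono) auto
  then show ?thesis by simp
qed

text \<open>The kernel at time \<open>s\<close> is the Gaussian of variance \<open>2 * s\<close>;
  its total mass is then that of a probability density.\<close>

lemma heat_kernel_1_eq_normal_density:
  fixes m u :: real
  assumes "0 < s"
  shows "heat_kernel 1 (m - u) s = normal_density m (sqrt (2 * s)) u"
  using assms
  by (simp add: heat_kernel_def normal_density_def powr_minus powr_half_sqrt field_simps power2_commute)

text \<open>The squared norm is the sum of the squared coordinates, so the exponential factorises.
  This reduces the total mass to one dimension.\<close>

lemma heat_kernel_eq_prod:
  fixes z :: "'a::euclidean_space"
  assumes "0 < s"
  shows "heat_kernel DIM('a) z s = (\<Prod>b\<in>Basis. heat_kernel 1 (z \<bullet> b) s)"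
proof -
  have "(\<Prod>b\<in>(Basis::'a set). (4 * pi * s) powr (- (1 / 2))) = (4 * pi * s) powr (- (real DIM('a) / 2))"
    using assms by (simp add: powr_powr flip: powr_realpow)
  moreover have "(norm z)\<^sup>2 = (\<Sum>b\<in>Basis. (z \<bullet> b)\<^sup>2)"
    unfolding power2_norm_eq_inner by (subst euclidean_inner) (simp add: power2_eq_square)
  ultimately show ?thesis
    unfolding heat_kernel_def
    by (simp add: prod.distrib exp_sum[symmetric] sum_negf sum_divide_distrib)
qed

lemma nn_integral_normal_density:
  assumes "0 < \<sigma>"
  shows "(\<integral>\<^sup>+x. ennreal (normal_density \<mu> \<sigma> x) \<partial>lborel) = 1"
  using assms by (simp add: nn_integral_eq_integral)

lemma nn_integral_heat_kernel:
  fixes x :: "'a::euclidean_space"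
  assumes "0 < s"
  shows "(\<integral>\<^sup>+y. ennreal (heat_kernel DIM('a) (x - y) s) \<partial>lborel) = 1"
proof -
  have "(\<integral>\<^sup>+y. ennreal (heat_kernel DIM('a) (x - y) s) \<partial>lborel)
      = (\<integral>\<^sup>+y. (\<Prod>b\<in>Basis. ennreal (normal_density (x \<bullet> b) (sqrt (2 * s)) (y \<bullet> b))) \<partial>lborel)"
    by (intro nn_integral_cong)
      (simp only: heat_kernel_eq_prod[OF assms] inner_diff_left heat_kernel_1_eq_normal_density[OF assms]
        prod_ennreal normal_density_nonneg)
  also have "\<dots> = (\<Prod>b\<in>(Basis::'a set). \<integral>\<^sup>+u. ennreal (normal_density (x \<bullet> b) (sqrt (2 * s)) u) \<partial>lborel)"
    by (rule nn_integral_lborel_prod) auto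
  also have "\<dots> = 1" using assms by (simp add: nn_integral_normal_density)
  finally show ?thesis .
qed

text \<open>At \<open>s = 0\<close> both sides are 0, because \<open>0 powr _\<close> and division
  by 0 are 0. The closed form thus replaces \<open>deriv\<close> everywhere and makes measurability
  immediate.\<close>

lemma dGamma1_eq: "dGamma1 \<xi> s = - (\<xi> / (2 * s)) * heat_kernel 1 \<xi> s"
proof (cases "s = 0")
  case True
  then show ?thesis by (simp add: dGamma1_def heat_kernel_def)
next
  case False
  have "((\<lambda>\<eta>. heat_kernel 1 \<eta> s) has_real_derivative - (\<xi> / (2 * s)) * heat_kernel 1 \<xi> s) (at \<xi>)"
    unfolding heat_kernel_def using False
    by (auto intro!: derivative_eq_intros simp: field_simps)
  then show ?thesis unfolding dGamma1_def by (rule DERIV_imp_deriv)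
qed

lemma borel_measurable_dGamma1 [measurable (raw)]:
  assumes [measurable]: "f \<in> borel_measurable M" "g \<in> borel_measurable M"
  shows "(\<lambda>x. dGamma1 (f x) (g x)) \<in> borel_measurable M"
  unfolding dGamma1_eq by measurable

text \<open>With \<open>u = (a + y) / sqrt s\<close>, half of the exponent \<open>u^2 / 4\<close>
  absorbs the linear factor through \<open>u * exp (- u^2 / 8) \<le> 2\<close>. The other half
  separates the variables by \<open>(a + y)^2 \<ge> a^2 + y^2\<close>.\<close>

lemma abs_dGamma1_le:
  assumes a: "0 \<le> a" and y: "0 \<le> y" and s: "0 < s"
  shows "2 * \<bar>dGamma1 (a + y) s\<bar> \<le> exp (- a\<^sup>2 / (8 * s)) / s * exp (- y\<^sup>2 / (8 * s))"
proof -
  define X where "X = a + y"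
  define u where "u = X / sqrt s"
  have X: "0 \<le> X" using a y by (simp add: X_def)
  have u: "X = u * sqrt s" "u\<^sup>2 = X\<^sup>2 / s" using s by (simp_all add: u_def power_divide)
  have "u \<le> 2 * (1 + u\<^sup>2 / 8)"
    using zero_le_power2[of "u - 2"] by (simp add: power2_eq_square algebra_simps)
  also have "\<dots> \<le> 2 * exp (u\<^sup>2 / 8)" by (intro mult_left_mono exp_ge_add_one_self) auto
  finally have ue: "u * exp (- u\<^sup>2 / 8) \<le> 2"
    using mult_right_mono[of u "2 * exp (u\<^sup>2 / 8)" "exp (- u\<^sup>2 / 8)"]
    by (simp add: mult.assoc flip: exp_add)
  have hk: "heat_kernel 1 X s = exp (- u\<^sup>2 / 4) / sqrt (4 * pi * s)"
  proof -
    have "- (norm X)\<^sup>2 / (4 * s) = - u\<^sup>2 / 4" unfolding u(2) by simp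
    moreover have "(4 * pi * s) powr (- (real 1 / 2)) = 1 / sqrt (4 * pi * s)"
      using s by (simp add: powr_minus_divide powr_half_sqrt)
    ultimately show ?thesis by (simp only: heat_kernel_def) simp
  qed
  have "sqrt 4 * sqrt s \<le> sqrt (4 * pi * s)"
    unfolding real_sqrt_mult[symmetric] using s pi_gt3
    by (intro real_sqrt_le_mono mult_right_mono) auto
  then have sq: "2 * sqrt s \<le> sqrt (4 * pi * s)" by simp
  have "2 * \<bar>dGamma1 X s\<bar> = X / s * heat_kernel 1 X s"
    using X s by (simp add: dGamma1_eq abs_mult)
  also have "\<dots> = u * sqrt s / s * (exp (- u\<^sup>2 / 4) / sqrt (4 * pi * s))"
    by (simp only: hk flip: u(1))
  also have "\<dots> \<le> u * sqrt s / s * (exp (- u\<^sup>2 / 4) / (2 * sqrt s))"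
    using sq s X by (intro mult_left_mono divide_left_mono) (auto simp: u_def)
  also have "\<dots> = (u * exp (- u\<^sup>2 / 8)) * exp (- u\<^sup>2 / 8) / (2 * s)"
    using s by (simp add: exp_add[symmetric] field_simps)
  also have "\<dots> \<le> 2 * exp (- u\<^sup>2 / 8) / (2 * s)"
    using ue s by (intro divide_right_mono mult_right_mono) auto
  also have "\<dots> = exp (- X\<^sup>2 / (8 * s)) / s" by (simp add: u(2) mult_ac)
  also have "\<dots> \<le> exp (- a\<^sup>2 / (8 * s) + - y\<^sup>2 / (8 * s)) / s"
  proof -
    have "a\<^sup>2 + y\<^sup>2 \<le> X\<^sup>2" using a y by (simp add: X_def power2_sum)
    then have "- X\<^sup>2 / (8 * s) \<le> - (a\<^sup>2 + y\<^sup>2) / (8 * s)" using s by (intro divide_right_mono) auto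
    then show ?thesis using s by (simp add: divide_right_mono add_divide_distrib diff_divide_distrib)
  qed
  also have "\<dots> = exp (- a\<^sup>2 / (8 * s)) / s * exp (- y\<^sup>2 / (8 * s))"
    by (simp only: exp_add times_divide_eq_left)
  finally show ?thesis by (simp only: X_def)
qed

section \<open>Spatial smoothing estimates for data in \<open>L^p\<close>\<close>

text \<open>The smoothing of the heat semigroup from \<open>L^p\<close> to bounded functions, with
  \<open>1 + A\<close> in place of the norm. The kernel enters the split through its mass 1 and its
  supremum bound.\<close>

lemma heat_kernel_Lp_bound:
  fixes f :: "'a::euclidean_space \<Rightarrow> real"
  assumes f: "f \<in> borel_measurable lebesgue"
    and A: "(\<integral>\<^sup>+y. ennreal (\<bar>f y\<bar> powr p) \<partial>lebesgue) \<le> ennreal A" "0 \<le> A"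
    and p: "1 \<le> p" and s: "0 < \<sigma>"
  shows "(\<integral>\<^sup>+y. ennreal (heat_kernel DIM('a) (x - y) \<sigma> * \<bar>f y\<bar>) \<partial>lebesgue)
    \<le> ennreal (\<sigma> powr (- (real DIM('a) / (2 * p))) * (1 + A))"
proof -
  \<comment> \<open>This level satisfies
    \<open>l powr p = \<sigma> powr (- (real DIM('a) / 2))\<close>, so both terms of the split are
    multiples of \<open>l\<close>.\<close>
  define l where "l = \<sigma> powr (- (real DIM('a) / (2 * p)))"
  have "(\<integral>\<^sup>+y. ennreal (heat_kernel DIM('a) (x - y) \<sigma> * \<bar>f y\<bar>) \<partial>lebesgue)
    \<le> ennreal (l * 1 + l powr (1 - p) * \<sigma> powr (- (real DIM('a) / 2)) * A)"
    using s by (intro nn_integral_mult_le_split f heat_kernel_le_powr A p)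
      (auto simp: l_def nn_integral_completion nn_integral_heat_kernel intro: measurable_completion)
  also have "l powr (1 - p) * \<sigma> powr (- (real DIM('a) / 2)) = l"
    using p by (simp add: l_def powr_powr flip: powr_add) (simp add: field_simps)
  finally show ?thesis by (simp add: l_def distrib_left)
qed

text \<open>The same split with the same level. The Gaussian in the normal variable is
  \<open>sqrt (8 * pi * s)\<close> times a density of variance \<open>4 * s\<close>, so the kernel
  has that mass while its supremum bound is unchanged.\<close>

lemma heat_kernel_gauss_Lp_bound:
  fixes f :: "'a::euclidean_space \<times> real \<Rightarrow> real"
  assumes f: "f \<in> borel_measurable lebesgue"
    and A: "(\<integral>\<^sup>+y. ennreal (\<bar>f y\<bar> powr p) \<partial>lebesgue) \<le> ennreal A" "0 \<le> A"
    and p: "1 \<le> p" and sg: "0 < \<sigma>" and s: "0 < s"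
  shows "(\<integral>\<^sup>+y. ennreal (heat_kernel DIM('a) (x - fst y) \<sigma> * exp (- (snd y)\<^sup>2 / (8 * s)) * \<bar>f y\<bar>) \<partial>lebesgue)
    \<le> ennreal (\<sigma> powr (- (real DIM('a) / (2 * p))) * (sqrt (8 * pi * s) + A))"
proof -
  define l where "l = \<sigma> powr (- (real DIM('a) / (2 * p)))"
  let ?g = "\<lambda>y::'a \<times> real. heat_kernel DIM('a) (x - fst y) \<sigma> * exp (- (snd y)\<^sup>2 / (8 * s))"
  have e: "exp (- u\<^sup>2 / (8 * s)) = sqrt (8 * pi * s) * normal_density 0 (sqrt (4 * s)) u" for u
    using s by (simp add: normal_density_def mult.assoc)
  have "(\<integral>\<^sup>+y. ennreal (?g y) \<partial>lebesgue) = (\<integral>\<^sup>+y. ennreal (?g y) \<partial>(lborel \<Otimes>\<^sub>M lborel))"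
    by (simp add: nn_integral_completion lborel_prod)
  also have "\<dots> = (\<integral>\<^sup>+y'. \<integral>\<^sup>+u. ennreal (?g (y', u)) \<partial>lborel \<partial>lborel)"
    by (rule lborel.nn_integral_fst[symmetric]) simp
  also have "\<dots> = (\<integral>\<^sup>+y'. ennreal (heat_kernel DIM('a) (x - y') \<sigma>) * ennreal (sqrt (8 * pi * s)) \<partial>lborel)"
  proof (rule nn_integral_cong)
    fix y' :: 'a
    have "(\<integral>\<^sup>+u. ennreal (?g (y', u)) \<partial>lborel)
        = (\<integral>\<^sup>+u. ennreal (heat_kernel DIM('a) (x - y') \<sigma> * sqrt (8 * pi * s)) * ennreal (normal_density 0 (sqrt (4 * s)) u) \<partial>lborel)"
      by (intro nn_integral_cong) (use s in \<open>simp only: e fst_conv snd_conv mult.assoc normal_density_nonneg heat_kernel_nonneg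
            real_sqrt_ge_zero mult_nonneg_nonneg flip: ennreal_mult, simp add: mult.assoc flip: ennreal_mult\<close>)
    then show "(\<integral>\<^sup>+u. ennreal (?g (y', u)) \<partial>lborel) = ennreal (heat_kernel DIM('a) (x - y') \<sigma>) * ennreal (sqrt (8 * pi * s))"
      using s by (simp add: nn_integral_cmult nn_integral_normal_density ennreal_mult)
  qed
  also have "\<dots> = ennreal (sqrt (8 * pi * s))"
    using sg by (simp add: nn_integral_multc nn_integral_heat_kernel)
  finally have B: "(\<integral>\<^sup>+y. ennreal (?g y) \<partial>lebesgue) \<le> ennreal (sqrt (8 * pi * s))" by simp
  have "?g \<in> borel_measurable (borel \<Otimes>\<^sub>M borel)" by measurable
  then have g: "?g \<in> borel_measurable lebesgue" by (intro measurable_completion) (simp add: borel_prod)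
  have S: "?g y \<le> \<sigma> powr (- (real DIM('a) / 2))" for y
  proof -
    have "?g y \<le> \<sigma> powr (- (real DIM('a) / 2)) * 1"
      using s by (intro mult_mono heat_kernel_le_powr sg) auto
    then show ?thesis by simp
  qed
  have "(\<integral>\<^sup>+y. ennreal (?g y * \<bar>f y\<bar>) \<partial>lebesgue)
    \<le> ennreal (l * sqrt (8 * pi * s) + l powr (1 - p) * \<sigma> powr (- (real DIM('a) / 2)) * A)"
    using s sg by (intro nn_integral_mult_le_split f g A p B S) (auto simp: l_def)
  also have "l powr (1 - p) * \<sigma> powr (- (real DIM('a) / 2)) = l"
    using p by (simp add: l_def powr_powr flip: powr_add) (simp add: field_simps)
  finally show ?thesis by (simp add: l_def distrib_left)
qed

section \<open>Data integrated against \<open>Hk\<close>\<close>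

lemma f_p_nonneg:
  assumes "1 \<le> r"
  shows "0 \<le> f_p p n r"
  using assms by (simp add: f_p_def)

text \<open>The interval integral runs over the open interval, so the endpoint
  \<open>\<tau> = t\<close>, where \<open>(t - \<tau>) / \<epsilon>\<close> vanishes, never enters.
  The factor \<open>- 2\<close> moves inside to fit
  \<open>integral_time_superposition\<close>.\<close>

lemma Hk_eq_set_integral:
  fixes x y :: "'a::euclidean_space \<times> real"
  assumes "0 < t"
  shows "Hk \<epsilon> \<delta> k x y t = (LINT \<tau>:{0<..<t}|lborel.
    - 2 * (heat_kernel DIM('a) (fst x - fst y) ((t - \<tau>) / \<epsilon> + k / \<delta> * \<tau>) *
      dGamma1 (snd x + snd y + \<tau> / \<delta>) ((t - \<tau>) / \<epsilon>)))"
proof -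
  have "einterval 0 (ereal t) = {0<..<t}" by (simp add: zero_ereal_def)
  then show ?thesis
    unfolding set_integral_mult_right using assms by (simp add: Hk_def interval_lebesgue_integral_def)
qed

lemma abs_Hk_integrand_le:
  fixes x y :: "'a::euclidean_space \<times> real"
  assumes "0 < s" "0 \<le> snd x" "0 \<le> snd y" "0 \<le> b"
  shows "\<bar>- 2 * (heat_kernel DIM('a) (fst x - fst y) \<sigma> * dGamma1 (snd x + snd y + b) s)\<bar>
    \<le> exp (- (snd x + b)\<^sup>2 / (8 * s)) / s
      * (heat_kernel DIM('a) (fst x - fst y) \<sigma> * exp (- (snd y)\<^sup>2 / (8 * s)))"
proof -
  have "2 * \<bar>dGamma1 (snd x + b + snd y) s\<bar>
      \<le> exp (- (snd x + b)\<^sup>2 / (8 * s)) / s * exp (- (snd y)\<^sup>2 / (8 * s))"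
    using assms by (intro abs_dGamma1_le) auto
  then have "heat_kernel DIM('a) (fst x - fst y) \<sigma> * (2 * \<bar>dGamma1 (snd x + b + snd y) s\<bar>)
      \<le> heat_kernel DIM('a) (fst x - fst y) \<sigma>
        * (exp (- (snd x + b)\<^sup>2 / (8 * s)) / s * exp (- (snd y)\<^sup>2 / (8 * s)))"
    by (intro mult_left_mono) auto
  then show ?thesis by (simp add: abs_mult mult_ac add_ac)
qed

text \<open>The boundary term is the case \<open>Y y' = (y', 0)\<close>, the interior term the case \<open>Y = id\<close>.\<close>
lemma Hk_superposition_bound:
  fixes f :: "'b \<Rightarrow> real" and Y :: "'b \<Rightarrow> 'a::euclidean_space \<times> real"
  assumes e: "0 < \<epsilon>" and d: "0 < \<delta>" and R: "0 < R" and p: "1 \<le> p"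
    and M: "sigma_finite_measure M" and f [measurable]: "f \<in> borel_measurable M"
    and Y1 [measurable]: "(\<lambda>y. fst (Y y)) \<in> borel_measurable M"
    and Y2 [measurable]: "(\<lambda>y. snd (Y y)) \<in> borel_measurable M"
    and supp: "\<forall>y. f y \<noteq> 0 \<longrightarrow> 0 \<le> snd (Y y)"
    and AB: "0 \<le> A" "0 \<le> B"
    and Lp: "\<forall>x' \<sigma> s. 0 < \<sigma> \<longrightarrow> 0 < s \<longrightarrow>
      (\<integral>\<^sup>+y. ennreal (heat_kernel DIM('a) (x' - fst (Y y)) \<sigma> * exp (- (snd (Y y))\<^sup>2 / (8 * s)) * \<bar>f y\<bar>) \<partial>M)
        \<le> ennreal (\<sigma> powr (- (real DIM('a) / (2 * p))) * (B * sqrt s + A))"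
  obtains C where "0 \<le> C"
    "\<And>k x t. \<lbrakk>2 \<le> k; (x, t) \<in> Qset R\<rbrakk> \<Longrightarrow> integrable M (\<lambda>y. Hk \<epsilon> \<delta> k x (Y y) t * f y)"
    "\<And>k x t. \<lbrakk>2 \<le> k; (x, t) \<in> Qset R\<rbrakk> \<Longrightarrow>
      \<bar>LINT y|M. Hk \<epsilon> \<delta> k x (Y y) t * f y\<bar> \<le> C * f_p p DIM('a) k"
proof -
  define \<alpha> where "\<alpha> = real DIM('a) / (2 * p)"
  have al: "0 < \<alpha>" using p by (simp add: \<alpha>_def)
  have half_le_one: "1 / 2 \<le> (1::real)" by simp
  obtain W where W: "0 \<le> W" "\<And>k. 2 \<le> k \<Longrightarrow>
      (\<integral>\<^sup>+\<tau>. ennreal ((1 + k * \<tau>) powr (- \<alpha>) * (1 + \<tau>) powr (- 1)) * indicator {0..} \<tau> \<partial>lborel)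
        \<le> ennreal (W * f_p p DIM('a) k)"
    by (fact nn_integral_weight_f_p[OF p DIM_positive \<alpha>_def])
  \<comment> \<open>The factor \<open>1 / s\<close> from the kernel derivative meets
    \<open>B * sqrt s + A\<close> from the data, so the powers \<open>- 1 / 2\<close> and
    \<open>- 1\<close> of \<open>s\<close> both occur: hence two choices of \<beta>.\<close>
  obtain C1 where C1: "0 \<le> C1"
    "\<And>k xN t \<tau> s a. \<lbrakk>0 < k; 0 \<le> xN; R < xN + t; 0 < \<tau>; \<tau> < t; s = (t - \<tau>) / \<epsilon>; a = xN + \<tau> / \<delta>\<rbrakk> \<Longrightarrow>
      (s + k / \<delta> * \<tau>) powr (- \<alpha>) * s powr (- (1 / 2)) * exp (- a\<^sup>2 / (8 * s))
        \<le> C1 * ((1 + k * \<tau>) powr (- \<alpha>) * (1 + \<tau>) powr (- 1))"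
    by (fact kernel_time_weight_bound[OF e d R al order.refl])
  obtain C2 where C2: "0 \<le> C2"
    "\<And>k xN t \<tau> s a. \<lbrakk>0 < k; 0 \<le> xN; R < xN + t; 0 < \<tau>; \<tau> < t; s = (t - \<tau>) / \<epsilon>; a = xN + \<tau> / \<delta>\<rbrakk> \<Longrightarrow>
      (s + k / \<delta> * \<tau>) powr (- \<alpha>) * s powr (- 1) * exp (- a\<^sup>2 / (8 * s))
        \<le> C2 * ((1 + k * \<tau>) powr (- \<alpha>) * (1 + \<tau>) powr (- 1))"
    by (fact kernel_time_weight_bound[OF e d R al half_le_one])
  define C where "C = B * C1 + A * C2"
  have C: "0 \<le> C" using AB C1 C2 by (simp add: C_def)
  have main: "integrable M (\<lambda>y. Hk \<epsilon> \<delta> k x (Y y) t * f y) \<and>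
      \<bar>LINT y|M. Hk \<epsilon> \<delta> k x (Y y) t * f y\<bar> \<le> C * (W * f_p p DIM('a) k)"
    if k: "2 \<le> k" and xt: "(x, t) \<in> Qset R" for k t and x :: "'a \<times> real"
  proof -
    have x: "0 \<le> snd x" "R < snd x + t" and t: "0 < t" using xt by (auto simp: Qset_def)
    let ?h = "\<lambda>\<tau> y. - 2 * (heat_kernel DIM('a) (fst x - fst (Y y)) ((t - \<tau>) / \<epsilon> + k / \<delta> * \<tau>) *
      dGamma1 (snd x + snd (Y y) + \<tau> / \<delta>) ((t - \<tau>) / \<epsilon>))"
    let ?w = "\<lambda>\<tau>. (1 + k * \<tau>) powr (- \<alpha>) * (1 + \<tau>) powr (- 1)"
    have h: "case_prod ?h \<in> borel_measurable (lborel \<Otimes>\<^sub>M M)" by measurable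
    have hf: "(\<integral>\<^sup>+y. ennreal (\<bar>?h \<tau> y\<bar> * \<bar>f y\<bar>) \<partial>M) \<le> ennreal C * ennreal (?w \<tau>)"
      if "\<tau> \<in> {0<..<t}" for \<tau>
    proof -
      have tau: "0 < \<tau>" "\<tau> < t" using that by auto
      define s where "s = (t - \<tau>) / \<epsilon>"
      define a where "a = snd x + \<tau> / \<delta>"
      define \<sigma> where "\<sigma> = s + k / \<delta> * \<tau>"
      define E where "E = exp (- a\<^sup>2 / (8 * s)) / s"
      have s: "0 < s" using tau e by (simp add: s_def)
      have sg: "0 < \<sigma>" using s k d tau by (simp add: \<sigma>_def add_pos_pos)
      have E: "0 \<le> E" using s by (simp add: E_def)
      have "(\<integral>\<^sup>+y. ennreal (\<bar>?h \<tau> y\<bar> * \<bar>f y\<bar>) \<partial>M)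
          \<le> (\<integral>\<^sup>+y. ennreal E * ennreal (heat_kernel DIM('a) (fst x - fst (Y y)) \<sigma> * exp (- (snd (Y y))\<^sup>2 / (8 * s)) * \<bar>f y\<bar>) \<partial>M)"
      proof (rule nn_integral_mono)
        fix y
        have "\<bar>?h \<tau> y\<bar> * \<bar>f y\<bar>
          \<le> E * (heat_kernel DIM('a) (fst x - fst (Y y)) \<sigma> * exp (- (snd (Y y))\<^sup>2 / (8 * s))) * \<bar>f y\<bar>"
        \<comment> \<open>The kernel estimate requires a nonnegative normal coordinate; where that
          fails, \<open>supp\<close> says that the data vanish.\<close>
        proof (cases "f y = 0")
          case True
          then show ?thesis by simp
        next
          case False
          then have "0 \<le> snd (Y y)" using supp by blast
          then show ?thesis
            unfolding E_def a_def \<sigma>_def s_def[symmetric]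
            using s x tau d by (intro mult_right_mono abs_Hk_integrand_le) auto
        qed
        then show "ennreal (\<bar>?h \<tau> y\<bar> * \<bar>f y\<bar>)
          \<le> ennreal E * ennreal (heat_kernel DIM('a) (fst x - fst (Y y)) \<sigma> * exp (- (snd (Y y))\<^sup>2 / (8 * s)) * \<bar>f y\<bar>)"
          using E by (simp add: ennreal_leI mult.assoc flip: ennreal_mult)
      qed
      also have "\<dots> = ennreal E * (\<integral>\<^sup>+y. ennreal (heat_kernel DIM('a) (fst x - fst (Y y)) \<sigma> * exp (- (snd (Y y))\<^sup>2 / (8 * s)) * \<bar>f y\<bar>) \<partial>M)"
        by (rule nn_integral_cmult) measurable
      also have "\<dots> \<le> ennreal E * ennreal (\<sigma> powr (- \<alpha>) * (B * sqrt s + A))"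
        unfolding \<alpha>_def by (intro mult_left_mono Lp[rule_format] sg s) auto
      also have "\<dots> = ennreal (E * (\<sigma> powr (- \<alpha>) * (B * sqrt s + A)))"
        using E AB s by (simp add: ennreal_mult)
      also have "\<dots> \<le> ennreal (C * ?w \<tau>)"
      proof (rule ennreal_leI)
        have s1: "s powr (- 1) = 1 / s" and s2: "s powr (- (1 / 2)) = sqrt s / s"
          using s by (simp_all add: powr_minus_divide powr_half_sqrt real_div_sqrt field_simps)
        have "E * (\<sigma> powr (- \<alpha>) * (B * sqrt s + A))
            = B * (\<sigma> powr (- \<alpha>) * s powr (- (1 / 2)) * exp (- a\<^sup>2 / (8 * s)))
              + A * (\<sigma> powr (- \<alpha>) * s powr (- 1) * exp (- a\<^sup>2 / (8 * s)))"
          unfolding s1 s2 E_def by (simp add: algebra_simps add_divide_distrib)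
        also have "\<dots> \<le> B * (C1 * ?w \<tau>) + A * (C2 * ?w \<tau>)"
          unfolding \<sigma>_def using k x tau AB
          by (intro add_mono mult_left_mono C1(2)[OF _ _ _ _ _ s_def a_def] C2(2)[OF _ _ _ _ _ s_def a_def]) auto
        also have "\<dots> = C * ?w \<tau>" by (simp only: C_def distrib_right mult.assoc)
        finally show "E * (\<sigma> powr (- \<alpha>) * (B * sqrt s + A)) \<le> C * ?w \<tau>" .
      qed
      also have "\<dots> = ennreal C * ennreal (?w \<tau>)" by (rule ennreal_mult) (use C in auto)
      finally show ?thesis .
    qed
    \<comment> \<open>Enlarging the time interval to the half line makes the bound independent of
      \<open>t\<close>.\<close>
    have "(\<integral>\<^sup>+\<tau>. ennreal (?w \<tau>) * indicator {0<..<t} \<tau> \<partial>lborel)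
        \<le> (\<integral>\<^sup>+\<tau>. ennreal (?w \<tau>) * indicator {0..} \<tau> \<partial>lborel)"
      by (intro nn_integral_mono) (auto split: split_indicator)
    then have Wk: "(\<integral>\<^sup>+\<tau>. ennreal (?w \<tau>) * indicator {0<..<t} \<tau> \<partial>lborel) \<le> ennreal (W * f_p p DIM('a) k)"
      using W(2)[OF k] by (rule order_trans)
    have W0: "0 \<le> W * f_p p DIM('a) k" using W(1) f_p_nonneg k by simp
    have w: "?w \<in> borel_measurable borel" by measurable
    note sup = integral_time_superposition[OF M h f _ w hf Wk C W0]
    show ?thesis unfolding Hk_eq_set_integral[OF t] using sup by auto
  qed
  show ?thesis
    by (rule that[of "C * W"]) (use C W main in \<open>auto simp: mult.assoc\<close>)
qed

text \<open>Both integrals on the left are the junk value 0 when \<open>g\<close> is not integrable, so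
  integrability of \<open>g\<close> need not be known.\<close>
lemma abs_integral_add_diff_le:
  fixes g h :: "'b \<Rightarrow> real"
  assumes h: "integrable M h"
  shows "\<bar>(LINT y|M. g y + h y) - (LINT y|M. g y)\<bar> \<le> \<bar>LINT y|M. h y\<bar>"
proof (cases "integrable M g")
  case True
  then show ?thesis using h by simp
next
  case False
  then have "\<not> integrable M (\<lambda>y. g y + h y)"
    using Bochner_Integration.integrable_diff[OF _ h, of "\<lambda>y. g y + h y"] by auto
  then show ?thesis using False by (simp add: not_integrable_integral_eq)
qed

section \<open>The difference of the two solutions\<close>

theorem theorem5p4:
  fixes \<phi> :: "'a::euclidean_space \<times> real \<Rightarrow> real" and \<psi> :: "'a \<Rightarrow> real"
    and p \<epsilon> \<delta> R :: real
  assumes "1 \<le> p" and "\<epsilon> > 0" and "\<delta> > 0"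
    and "set_borel_measurable lebesgue half_space \<phi>"
    and "set_integrable lebesgue half_space (\<lambda>y. \<bar>\<phi> y\<bar> powr p)"
    and "\<psi> \<in> borel_measurable lebesgue"
    and "integrable lebesgue (\<lambda>y. \<bar>\<psi> y\<bar> powr p)"
    and "R > 0"
  shows "\<exists>C. \<forall>\<^sub>F k in at_top. \<forall>(x, t) \<in> Qset R.
           \<bar>u_k \<epsilon> \<delta> k \<phi> \<psi> x t - zD \<epsilon> \<phi> x t\<bar> \<le> C * f_p p DIM('a) k"
proof -
  \<comment> \<open>Extension by 0 turns integrals over the half space into integrals over the whole
    space, and \<open>f\<close> inherits measurability from the set-wise hypothesis on
    \<phi>.\<close>
  define f where "f = (\<lambda>y. indicator half_space y * \<phi> y)"
  have f: "f \<in> borel_measurable lebesgue"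
    using assms(4) by (simp add: f_def set_borel_measurable_def)
  have "\<bar>f y\<bar> powr p = indicator half_space y *\<^sub>R \<bar>\<phi> y\<bar> powr p" for y
    by (simp add: f_def split: split_indicator)
  then have fp: "integrable lebesgue (\<lambda>y. \<bar>f y\<bar> powr p)"
    using assms(5) by (simp add: set_integrable_def)
  have supp: "\<forall>y. f y \<noteq> 0 \<longrightarrow> 0 \<le> snd y"
    by (simp add: f_def half_space_def indicator_def)
  have meas: "(fst :: 'a \<times> real \<Rightarrow> 'a) \<in> borel_measurable lebesgue"
    "(snd :: 'a \<times> real \<Rightarrow> real) \<in> borel_measurable lebesgue"
    by (auto intro!: measurable_completion simp flip: borel_prod)
  have meas': "(\<lambda>y::'a. fst (y, 0::real)) \<in> borel_measurable lebesgue"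
    "(\<lambda>y::'a. snd (y, 0::real)) \<in> borel_measurable lebesgue"
    by (auto intro!: measurable_completion)
  define A where "A = (LINT y|lebesgue. \<bar>f y\<bar> powr p)"
  have A: "(\<integral>\<^sup>+y. ennreal (\<bar>f y\<bar> powr p) \<partial>lebesgue) \<le> ennreal A" "0 \<le> A"
    unfolding A_def using fp by (simp_all add: nn_integral_eq_integral)
  define A' where "A' = (LINT y|lebesgue. \<bar>\<psi> y\<bar> powr p)"
  have A': "(\<integral>\<^sup>+y. ennreal (\<bar>\<psi> y\<bar> powr p) \<partial>lebesgue) \<le> ennreal A'" "0 \<le> A'"
    unfolding A'_def using assms(7) by (simp_all add: nn_integral_eq_integral)
  have B: "0 \<le> sqrt (8 * pi)" and B': "0 \<le> 1 + A'" using A'(2) by simp_all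
  have supp': "\<forall>y. \<psi> y \<noteq> 0 \<longrightarrow> 0 \<le> snd (y, 0::real)" by simp
  have Lp: "\<forall>x' \<sigma> s. 0 < \<sigma> \<longrightarrow> 0 < s \<longrightarrow> (\<integral>\<^sup>+y. ennreal (heat_kernel DIM('a) (x' - fst y) \<sigma> * exp (- (snd y)\<^sup>2 / (8 * s)) * \<bar>f y\<bar>) \<partial>lebesgue)
      \<le> ennreal (\<sigma> powr (- (real DIM('a) / (2 * p))) * (sqrt (8 * pi) * sqrt s + A))"
    using heat_kernel_gauss_Lp_bound[OF f A assms(1)] by (simp add: real_sqrt_mult)
  \<comment> \<open>On the boundary the normal coordinate is 0, so the Gaussian factor is 1 and the
    coefficient of \<open>sqrt s\<close> is taken to be 0.\<close>
  have Lp': "\<forall>x' \<sigma> s. 0 < \<sigma> \<longrightarrow> 0 < s \<longrightarrow> (\<integral>\<^sup>+y. ennreal (heat_kernel DIM('a) (x' - fst (y, 0::real)) \<sigma>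
        * exp (- (snd (y, 0::real))\<^sup>2 / (8 * s)) * \<bar>\<psi> y\<bar>) \<partial>lebesgue)
      \<le> ennreal (\<sigma> powr (- (real DIM('a) / (2 * p))) * (0 * sqrt s + (1 + A')))"
    using heat_kernel_Lp_bound[OF assms(6) A' assms(1)] by simp
  obtain C1 where C1: "0 \<le> C1"
    "\<And>k x t. \<lbrakk>2 \<le> k; (x, t) \<in> Qset R\<rbrakk> \<Longrightarrow> integrable lebesgue (\<lambda>y. Hk \<epsilon> \<delta> k x y t * f y)"
    "\<And>k x t. \<lbrakk>2 \<le> k; (x, t) \<in> Qset R\<rbrakk> \<Longrightarrow>
      \<bar>LINT y|lebesgue. Hk \<epsilon> \<delta> k x y t * f y\<bar> \<le> C1 * f_p p DIM('a) k"
    by (fact Hk_superposition_bound[where Y = "\<lambda>y. y", OF assms(2,3,8,1) sigma_finite_lebesgue f meas supp A(2) B Lp])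
  obtain C2 where C2: "0 \<le> C2"
    "\<And>k x t. \<lbrakk>2 \<le> k; (x, t) \<in> Qset R\<rbrakk> \<Longrightarrow> integrable lebesgue (\<lambda>y. Hk \<epsilon> \<delta> k x (y, 0) t * \<psi> y)"
    "\<And>k x t. \<lbrakk>2 \<le> k; (x, t) \<in> Qset R\<rbrakk> \<Longrightarrow>
      \<bar>LINT y|lebesgue. Hk \<epsilon> \<delta> k x (y, 0) t * \<psi> y\<bar> \<le> C2 * f_p p DIM('a) k"
    by (fact Hk_superposition_bound[where Y = "\<lambda>y. (y, 0)", OF assms(2,3,8,1) sigma_finite_lebesgue assms(6) meas'
          supp' B' order.refl Lp'])
  have bound: "\<bar>u_k \<epsilon> \<delta> k \<phi> \<psi> x t - zD \<epsilon> \<phi> x t\<bar> \<le> (C1 / \<delta> + C2 / \<epsilon>) * f_p p DIM('a) k"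
    if k: "2 \<le> k" and xt: "(x, t) \<in> Qset R" for k x t
  proof -
    let ?g = "\<lambda>y. G0 x y (t / \<epsilon>) * f y" and ?h = "\<lambda>y. Hk \<epsilon> \<delta> k x y t * f y / \<delta>"
    let ?I = "LINT y|lebesgue. Hk \<epsilon> \<delta> k x y t * f y" and ?J = "LINT y|lebesgue. Hk \<epsilon> \<delta> k x (y, 0) t * \<psi> y"
    have z: "zD \<epsilon> \<phi> x t = (LINT y|lebesgue. ?g y)"
      by (simp add: zD_def set_lebesgue_integral_def f_def mult_ac)
    \<comment> \<open>Reflection fixes boundary points, so the two heat kernels cancel.\<close>
    have G0: "G0 x (y, 0) s = 0" for y s by (simp add: G0_def refl_pt_def)
    \<comment> \<open>In the boundary term the weight \<open>\<delta> / \<epsilon>\<close> meets the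
      \<open>1 / \<delta>\<close> in front of \<open>Hk\<close> and leaves
      \<open>1 / \<epsilon>\<close>.\<close>
    have u: "u_k \<epsilon> \<delta> k \<phi> \<psi> x t = (LINT y|lebesgue. ?g y + ?h y) + ?J / \<epsilon>"
    proof -
      have "(LINT y:half_space|lebesgue. Gk \<epsilon> \<delta> k x y t * \<phi> y) = (LINT y|lebesgue. ?g y + ?h y)"
        unfolding set_lebesgue_integral_def
        by (intro Bochner_Integration.integral_cong) (auto simp: f_def Gk_def algebra_simps)
      moreover have "(LINT y'|lebesgue. Gk \<epsilon> \<delta> k x (y', 0) t * \<psi> y') = ?J / \<delta>"
        by (simp add: Gk_def G0)
      ultimately show ?thesis using assms(3) by (simp add: u_k_def)
    qed
    have "\<bar>u_k \<epsilon> \<delta> k \<phi> \<psi> x t - zD \<epsilon> \<phi> x t\<bar>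
        \<le> \<bar>(LINT y|lebesgue. ?g y + ?h y) - (LINT y|lebesgue. ?g y)\<bar> + \<bar>?J / \<epsilon>\<bar>"
      unfolding u z by linarith
    also have "\<dots> \<le> \<bar>LINT y|lebesgue. ?h y\<bar> + \<bar>?J / \<epsilon>\<bar>"
      using C1(2)[OF k xt] by (intro add_right_mono abs_integral_add_diff_le integrable_divide) auto
    also have "\<dots> = \<bar>?I\<bar> / \<delta> + \<bar>?J\<bar> / \<epsilon>"
      using assms(2,3) by simp
    also have "\<dots> \<le> C1 * f_p p DIM('a) k / \<delta> + C2 * f_p p DIM('a) k / \<epsilon>"
      using assms(2,3) by (intro add_mono divide_right_mono C1(3) C2(3) k xt) auto
    finally show ?thesis by (simp add: distrib_right)
  qed
  show ?thesis
  proof (intro exI)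
    show "\<forall>\<^sub>F k in at_top. \<forall>(x, t) \<in> Qset R.
        \<bar>u_k \<epsilon> \<delta> k \<phi> \<psi> x t - zD \<epsilon> \<phi> x t\<bar> \<le> (C1 / \<delta> + C2 / \<epsilon>) * f_p p DIM('a) k"
      \<comment> \<open>The threshold 2 is inherited from the logarithmic case of the weight
        integral.\<close>
      using eventually_ge_at_top[of "2::real"]
      by eventually_elim (use bound in auto)
  qed
qed

end
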